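(* Let $p$ be an odd prime and let $A$ be a vertex of $G_p$, viewed as a nonzero singular matrix in $M_2(\mathbb{F}_p)$. (i) If $\operatorname{Ker}(A)=\operatorname{Im}(A)$, then $\deg(A)=2p(p-1)+(p-2)=2p^2-p-2$. (ii) If $\operatorname{Ker}(A)\neq\operatorname{Im}(A)$, then $\deg(A)=(2p+1)(p-1)=2p^2-p-1$. In particular, $G_p$ has exactly two distinct vertex degrees, and these differ by exactly $1$.
   Context: For $n\ge2$, $\mathbb{L}_n=\{a+bi+cj+dk: a,b,c,d\in\mathbb{Z}/n\mathbb{Z}\}$ is the ring of Lipschitz quaternions modulo $n$, with the usual relations $i^2=j^2=k^2=-1$, $ij=k=-ji$, $jk=i=-kj$, $ki=j=-ik$ taken modulo $n$. A nonzero element $x$ of a ring is a zero divisor if $xy=0$ or $yx=0$ for some nonzero $y$. $G_n=\Gamma(\mathbb{L}_n)$ is the simple undirected graph whose vertices are the nonzero zero divisors of $\mathbb{L}_n$, distinct $x,y$ being adjacent iff $xy=0$ or $yx=0$. For an odd prime $p$, $\mathbb{L}_p$ is identified with $M_2(\mathbb{F}_p)$ via a fixed ring isomorphism, so the vertices of $G_p$ are the nonzero singular $2\times2$ matrices over $\mathbb{F}_p$; kernels and images are those of the induced linear maps on $\mathbb{F}_p^2$. *)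

theory Defs
  imports "HOL-Number_Theory.Number_Theory" "HOL-Algebra.QuotRing"
begin

(* Quat a b c d stands for a + b i + c j + d k; the product is the bilinear
   extension of i^2 = j^2 = k^2 = -1, i j = k = - j i, j k = i = - k j, k i = j = - i k. *)
datatype 'a quat = Quat 'a 'a 'a 'a

definition quat_ring :: "('a, 'm) ring_scheme \<Rightarrow> 'a quat ring" where
  "quat_ring R =
    \<lparr>carrier = {Quat a b c d | a b c d.
        a \<in> carrier R \<and> b \<in> carrier R \<and> c \<in> carrier R \<and> d \<in> carrier R},
     monoid.mult = (\<lambda>x y. case (x, y) of (Quat a b c d, Quat a' b' c' d') \<Rightarrow>
       Quat
        (a \<otimes>\<^bsub>R\<^esub> a' \<ominus>\<^bsub>R\<^esub> b \<otimes>\<^bsub>R\<^esub> b' \<ominus>\<^bsub>R\<^esub> c \<otimes>\<^bsub>R\<^esub> c' \<ominus>\<^bsub>R\<^esub> d \<otimes>\<^bsub>R\<^esub> d')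
        (a \<otimes>\<^bsub>R\<^esub> b' \<oplus>\<^bsub>R\<^esub> b \<otimes>\<^bsub>R\<^esub> a' \<oplus>\<^bsub>R\<^esub> c \<otimes>\<^bsub>R\<^esub> d' \<ominus>\<^bsub>R\<^esub> d \<otimes>\<^bsub>R\<^esub> c')
        (a \<otimes>\<^bsub>R\<^esub> c' \<ominus>\<^bsub>R\<^esub> b \<otimes>\<^bsub>R\<^esub> d' \<oplus>\<^bsub>R\<^esub> c \<otimes>\<^bsub>R\<^esub> a' \<oplus>\<^bsub>R\<^esub> d \<otimes>\<^bsub>R\<^esub> b')
        (a \<otimes>\<^bsub>R\<^esub> d' \<oplus>\<^bsub>R\<^esub> b \<otimes>\<^bsub>R\<^esub> c' \<ominus>\<^bsub>R\<^esub> c \<otimes>\<^bsub>R\<^esub> b' \<oplus>\<^bsub>R\<^esub> d \<otimes>\<^bsub>R\<^esub> a')),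
     one = Quat \<one>\<^bsub>R\<^esub> \<zero>\<^bsub>R\<^esub> \<zero>\<^bsub>R\<^esub> \<zero>\<^bsub>R\<^esub>,
     zero = Quat \<zero>\<^bsub>R\<^esub> \<zero>\<^bsub>R\<^esub> \<zero>\<^bsub>R\<^esub> \<zero>\<^bsub>R\<^esub>,
     add = (\<lambda>x y. case (x, y) of (Quat a b c d, Quat a' b' c' d') \<Rightarrow>
       Quat (a \<oplus>\<^bsub>R\<^esub> a') (b \<oplus>\<^bsub>R\<^esub> b') (c \<oplus>\<^bsub>R\<^esub> c') (d \<oplus>\<^bsub>R\<^esub> d'))\<rparr>"

definition lipschitz_ring :: "nat \<Rightarrow> int quat ring" where
  "lipschitz_ring n = quat_ring (residue_ring (int n))"

(* Mat2 a b c d is the matrix with rows (a, b) and (c, d). *)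
datatype 'a mat2 = Mat2 'a 'a 'a 'a

definition mat2_ring :: "('a, 'm) ring_scheme \<Rightarrow> 'a mat2 ring" where
  "mat2_ring R =
    \<lparr>carrier = {Mat2 a b c d | a b c d.
        a \<in> carrier R \<and> b \<in> carrier R \<and> c \<in> carrier R \<and> d \<in> carrier R},
     monoid.mult = (\<lambda>x y. case (x, y) of (Mat2 a b c d, Mat2 a' b' c' d') \<Rightarrow>
       Mat2
        (a \<otimes>\<^bsub>R\<^esub> a' \<oplus>\<^bsub>R\<^esub> b \<otimes>\<^bsub>R\<^esub> c') (a \<otimes>\<^bsub>R\<^esub> b' \<oplus>\<^bsub>R\<^esub> b \<otimes>\<^bsub>R\<^esub> d')
        (c \<otimes>\<^bsub>R\<^esub> a' \<oplus>\<^bsub>R\<^esub> d \<otimes>\<^bsub>R\<^esub> c') (c \<otimes>\<^bsub>R\<^esub> b' \<oplus>\<^bsub>R\<^esub> d \<otimes>\<^bsub>R\<^esub> d')),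
     one = Mat2 \<one>\<^bsub>R\<^esub> \<zero>\<^bsub>R\<^esub> \<zero>\<^bsub>R\<^esub> \<one>\<^bsub>R\<^esub>,
     zero = Mat2 \<zero>\<^bsub>R\<^esub> \<zero>\<^bsub>R\<^esub> \<zero>\<^bsub>R\<^esub> \<zero>\<^bsub>R\<^esub>,
     add = (\<lambda>x y. case (x, y) of (Mat2 a b c d, Mat2 a' b' c' d') \<Rightarrow>
       Mat2 (a \<oplus>\<^bsub>R\<^esub> a') (b \<oplus>\<^bsub>R\<^esub> b') (c \<oplus>\<^bsub>R\<^esub> c') (d \<oplus>\<^bsub>R\<^esub> d'))\<rparr>"

fun mat2_apply :: "('a, 'm) ring_scheme \<Rightarrow> 'a mat2 \<Rightarrow> 'a \<times> 'a \<Rightarrow> 'a \<times> 'a" where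
  "mat2_apply R (Mat2 a b c d) (x, y) =
     (a \<otimes>\<^bsub>R\<^esub> x \<oplus>\<^bsub>R\<^esub> b \<otimes>\<^bsub>R\<^esub> y, c \<otimes>\<^bsub>R\<^esub> x \<oplus>\<^bsub>R\<^esub> d \<otimes>\<^bsub>R\<^esub> y)"

definition mat2_Ker :: "('a, 'm) ring_scheme \<Rightarrow> 'a mat2 \<Rightarrow> ('a \<times> 'a) set" where
  "mat2_Ker R A = {v \<in> carrier R \<times> carrier R. mat2_apply R A v = (\<zero>\<^bsub>R\<^esub>, \<zero>\<^bsub>R\<^esub>)}"

definition mat2_Im :: "('a, 'm) ring_scheme \<Rightarrow> 'a mat2 \<Rightarrow> ('a \<times> 'a) set" where
  "mat2_Im R A = mat2_apply R A ` (carrier R \<times> carrier R)"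

definition zero_divisors :: "('a, 'm) ring_scheme \<Rightarrow> 'a set" where
  "zero_divisors R = {x \<in> carrier R - {\<zero>\<^bsub>R\<^esub>}.
     \<exists>y \<in> carrier R - {\<zero>\<^bsub>R\<^esub>}. x \<otimes>\<^bsub>R\<^esub> y = \<zero>\<^bsub>R\<^esub> \<or> y \<otimes>\<^bsub>R\<^esub> x = \<zero>\<^bsub>R\<^esub>}"

(* A simple undirected graph: its vertex set and its set of edges, an edge being
   a two-element set of vertices. *)
type_synonym 'v sgraph = "'v set \<times> 'v set set"

definition verts :: "'v sgraph \<Rightarrow> 'v set" where
  "verts G = fst G"

definition edges :: "'v sgraph \<Rightarrow> 'v set set" where
  "edges G = snd G"

definition vertex_degree :: "'v sgraph \<Rightarrow> 'v \<Rightarrow> nat" where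
  "vertex_degree G v = card {e \<in> edges G. v \<in> e}"

definition zero_divisor_graph :: "('a, 'm) ring_scheme \<Rightarrow> 'a sgraph" where
  "zero_divisor_graph R =
    (zero_divisors R,
     {{x, y} | x y. x \<in> zero_divisors R \<and> y \<in> zero_divisors R \<and> x \<noteq> y \<and>
        (x \<otimes>\<^bsub>R\<^esub> y = \<zero>\<^bsub>R\<^esub> \<or> y \<otimes>\<^bsub>R\<^esub> x = \<zero>\<^bsub>R\<^esub>)})"

definition lipschitz_graph :: "nat \<Rightarrow> int quat sgraph" where
  "lipschitz_graph n = zero_divisor_graph (lipschitz_ring n)"

lemma residue_ring_simps:
  assumes "n > (1::nat)"
  shows "carrier (residue_ring (int n)) = {0..<int n}"
    "x \<otimes>\<^bsub>residue_ring (int n)\<^esub> y = (x * y) mod int n"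
    "x \<oplus>\<^bsub>residue_ring (int n)\<^esub> y = (x + y) mod int n"
    "\<one>\<^bsub>residue_ring (int n)\<^esub> = 1" "\<zero>\<^bsub>residue_ring (int n)\<^esub> = 0"
    "y \<in> {0..<int n} \<Longrightarrow> x \<ominus>\<^bsub>residue_ring (int n)\<^esub> y = (x - y) mod int n"
proof -
  interpret residues "int n" "residue_ring (int n)"
    using assms by unfold_locales auto
  show "carrier (residue_ring (int n)) = {0..<int n}" by (auto simp: res_carrier_eq)
  show "x \<otimes>\<^bsub>residue_ring (int n)\<^esub> y = (x * y) mod int n" by (simp add: res_mult_eq)
  show "x \<oplus>\<^bsub>residue_ring (int n)\<^esub> y = (x + y) mod int n" by (simp add: res_add_eq)
  show "\<one>\<^bsub>residue_ring (int n)\<^esub> = 1" by (simp add: res_one_eq)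
  show "\<zero>\<^bsub>residue_ring (int n)\<^esub> = 0" by (simp add: res_zero_eq)
  show "y \<in> {0..<int n} \<Longrightarrow> x \<ominus>\<^bsub>residue_ring (int n)\<^esub> y = (x - y) mod int n"
    unfolding a_minus_def by (subst res_neg_eq) (auto simp: res_carrier_eq res_add_eq mod_simps)
qed

lemma lipschitz_simps:
  assumes "n > (1::nat)"
  shows "carrier (lipschitz_ring n) = {Quat a b c d | a b c d.
      a \<in> {0..<int n} \<and> b \<in> {0..<int n} \<and> c \<in> {0..<int n} \<and> d \<in> {0..<int n}}"
    "Quat a b c d \<otimes>\<^bsub>lipschitz_ring n\<^esub> Quat a' b' c' d' = Quat
      ((a * a' - b * b' - c * c' - d * d') mod int n)
      ((a * b' + b * a' + c * d' - d * c') mod int n)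
      ((a * c' - b * d' + c * a' + d * b') mod int n)
      ((a * d' + b * c' - c * b' + d * a') mod int n)"
    "Quat a b c d \<oplus>\<^bsub>lipschitz_ring n\<^esub> Quat a' b' c' d' = Quat
      ((a + a') mod int n) ((b + b') mod int n) ((c + c') mod int n) ((d + d') mod int n)"
    "\<one>\<^bsub>lipschitz_ring n\<^esub> = Quat 1 0 0 0" "\<zero>\<^bsub>lipschitz_ring n\<^esub> = Quat 0 0 0 0"
  using assms by (auto simp: lipschitz_ring_def quat_ring_def residue_ring_simps mod_simps)

lemma mat2_residue_simps:
  assumes "n > (1::nat)"
  shows "carrier (mat2_ring (residue_ring (int n))) = {Mat2 a b c d | a b c d.
      a \<in> {0..<int n} \<and> b \<in> {0..<int n} \<and> c \<in> {0..<int n} \<and> d \<in> {0..<int n}}"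
    "Mat2 a b c d \<otimes>\<^bsub>mat2_ring (residue_ring (int n))\<^esub> Mat2 a' b' c' d' = Mat2
      ((a * a' + b * c') mod int n) ((a * b' + b * d') mod int n)
      ((c * a' + d * c') mod int n) ((c * b' + d * d') mod int n)"
    "Mat2 a b c d \<oplus>\<^bsub>mat2_ring (residue_ring (int n))\<^esub> Mat2 a' b' c' d' = Mat2
      ((a + a') mod int n) ((b + b') mod int n) ((c + c') mod int n) ((d + d') mod int n)"
    "\<one>\<^bsub>mat2_ring (residue_ring (int n))\<^esub> = Mat2 1 0 0 1"
    "\<zero>\<^bsub>mat2_ring (residue_ring (int n))\<^esub> = Mat2 0 0 0 0"
  using assms by (auto simp: mat2_ring_def residue_ring_simps mod_simps)

lemma mod_eqI:
  "[l = x] (mod n) \<Longrightarrow> [r = y] (mod n) \<Longrightarrow> x = y \<Longrightarrow> l mod n = r mod n" for n :: int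
  by (simp add: cong_def)

lemma mod_congI: "[a = b] (mod n) \<Longrightarrow> [a mod n = b] (mod n)" for n :: int
  by simp

lemma lipschitz_ring_ring:
  assumes "n > (1::nat)"
  shows "ring (lipschitz_ring n)"
proof (rule ringI)
  note s = lipschitz_simps[OF assms]
  show "abelian_group (lipschitz_ring n)"
  proof (rule abelian_groupI)
    fix x assume "x \<in> carrier (lipschitz_ring n)"
    then obtain a b c d where "x = Quat a b c d" by (auto simp: s)
    then show "\<exists>y \<in> carrier (lipschitz_ring n). y \<oplus>\<^bsub>lipschitz_ring n\<^esub> x = \<zero>\<^bsub>lipschitz_ring n\<^esub>"
      using assms
      by (intro bexI[of _ "Quat ((-a) mod n) ((-b) mod n) ((-c) mod n) ((-d) mod n)"])
        (auto simp: s mod_simps)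
  qed (use assms in \<open>auto simp: s mod_simps algebra_simps\<close>)
  show "monoid (lipschitz_ring n)"
  proof (rule monoidI)
    fix x y z assume "x \<in> carrier (lipschitz_ring n)" "y \<in> carrier (lipschitz_ring n)"
      "z \<in> carrier (lipschitz_ring n)"
    then obtain a b c d a' b' c' d' a'' b'' c'' d'' where
      xyz: "x = Quat a b c d" "y = Quat a' b' c' d'" "z = Quat a'' b'' c'' d''"
      by (auto simp: s)
    show "x \<otimes>\<^bsub>lipschitz_ring n\<^esub> y \<otimes>\<^bsub>lipschitz_ring n\<^esub> z =
        x \<otimes>\<^bsub>lipschitz_ring n\<^esub> (y \<otimes>\<^bsub>lipschitz_ring n\<^esub> z)"
      by (simp only: xyz s quat.inject, intro conjI;
          rule mod_eqI,
          (rule mod_congI | rule cong_add | rule cong_diff | rule cong_mult | rule cong_refl)+,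
          simp add: algebra_simps)
  qed (use assms in \<open>auto simp: s\<close>)
next
  note s = lipschitz_simps[OF assms]
  fix x y z assume "x \<in> carrier (lipschitz_ring n)" "y \<in> carrier (lipschitz_ring n)"
    "z \<in> carrier (lipschitz_ring n)"
  then obtain a b c d a' b' c' d' a'' b'' c'' d'' where
    xyz: "x = Quat a b c d" "y = Quat a' b' c' d'" "z = Quat a'' b'' c'' d''"
    by (auto simp: s)
  show "(x \<oplus>\<^bsub>lipschitz_ring n\<^esub> y) \<otimes>\<^bsub>lipschitz_ring n\<^esub> z =
      x \<otimes>\<^bsub>lipschitz_ring n\<^esub> z \<oplus>\<^bsub>lipschitz_ring n\<^esub> y \<otimes>\<^bsub>lipschitz_ring n\<^esub> z"
    by (simp only: xyz s quat.inject, intro conjI;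
        rule mod_eqI,
        (rule mod_congI | rule cong_add | rule cong_diff | rule cong_mult | rule cong_refl)+,
        simp add: algebra_simps)
  show "z \<otimes>\<^bsub>lipschitz_ring n\<^esub> (x \<oplus>\<^bsub>lipschitz_ring n\<^esub> y) =
      z \<otimes>\<^bsub>lipschitz_ring n\<^esub> x \<oplus>\<^bsub>lipschitz_ring n\<^esub> z \<otimes>\<^bsub>lipschitz_ring n\<^esub> y"
    by (simp only: xyz s quat.inject, intro conjI;
        rule mod_eqI,
        (rule mod_congI | rule cong_add | rule cong_diff | rule cong_mult | rule cong_refl)+,
        simp add: algebra_simps)
qed

lemma sum_two_squares_eq_minus_one:
  assumes "prime (p::nat)" "odd p"
  obtains r s :: int where "int p dvd r\<^sup>2 + s\<^sup>2 + 1"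
proof -
  define m where "m = (int p - 1) div 2"
  have pm: "int p = 2 * m + 1" using assms(2) by (auto simp: m_def elim: oddE)
  have pp: "prime (int p)" using assms(1) by simp
  have m0: "m \<ge> 1" using pm prime_ge_2_nat[OF assms(1)] assms(2) by presburger
  have inj: "x = y" if "x \<in> {0..m}" "y \<in> {0..m}" "int p dvd x\<^sup>2 - y\<^sup>2" for x y :: int
  proof -
    have "int p dvd (x - y) * (x + y)" using that(3) by (simp add: power2_eq_square algebra_simps)
    then have "int p dvd x - y \<or> int p dvd x + y" using pp by (simp add: prime_dvd_mult_iff)
    then show ?thesis
    proof
      assume "int p dvd x - y"
      then show ?thesis
        using that pm dvd_imp_le_int[of "x - y" "int p"] by (cases "x = y") auto
    next
      assume "int p dvd x + y"
      then show ?thesis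
        using that pm zdvd_not_zless[of "x + y" "int p"] by (cases "x + y = 0") auto
    qed
  qed
  define f g :: "int \<Rightarrow> int" where "f = (\<lambda>x. x\<^sup>2 mod int p)" and "g = (\<lambda>y. (- 1 - y\<^sup>2) mod int p)"
  have f: "inj_on f {0..m}"
    by (rule inj_onI) (auto simp: f_def mod_eq_dvd_iff intro!: inj)
  have g: "inj_on g {0..m}"
    by (rule inj_onI) (auto simp: g_def mod_eq_dvd_iff dvd_diff_commute intro!: inj)
  have "f ` {0..m} \<inter> g ` {0..m} \<noteq> {}"
  proof
    assume e: "f ` {0..m} \<inter> g ` {0..m} = {}"
    have "card (f ` {0..m} \<union> g ` {0..m}) = 2 * card {0..m}"
      using e f g by (simp add: card_Un_disjoint card_image)
    moreover have "card (f ` {0..m} \<union> g ` {0..m}) \<le> card {0..<int p}"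
      using prime_gt_0_nat[OF assms(1)]
      by (intro card_mono) (auto simp: f_def g_def pos_mod_sign pos_mod_bound)
    ultimately show False using pm m0 by simp
  qed
  then obtain r s where "f r = g s" by blast
  then have "int p dvd r\<^sup>2 + s\<^sup>2 + 1"
    by (simp add: f_def g_def mod_eq_dvd_iff algebra_simps)
  then show ?thesis by (rule that)
qed

(* The identification of L_p with M_2(F_p) exists: send i to the matrix with rows
   (0, -1), (1, 0) and j to the one with rows (r, s), (s, -r), where r^2 + s^2 = -1. *)
lemma lipschitz_mat2_iso:
  assumes "prime (p::nat)" "odd p"
  shows "ring_iso (lipschitz_ring p) (mat2_ring (residue_ring (int p))) \<noteq> {}"
proof -
  have p1: "p > 1" using assms(1) prime_gt_1_nat by blast
  note s = lipschitz_simps[OF p1] mat2_residue_simps[OF p1]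
  obtain r t :: int where rt: "int p dvd r\<^sup>2 + t\<^sup>2 + 1"
    using sum_two_squares_eq_minus_one[OF assms] by blast
  define \<phi> where "\<phi> = (\<lambda>x. case x of Quat a b c d \<Rightarrow>
    Mat2 ((a + r * c - t * d) mod int p) ((t * c + r * d - b) mod int p)
         ((b + t * c + r * d) mod int p) ((a - r * c + t * d) mod int p))"
  have car: "\<phi> ` carrier (lipschitz_ring p) \<subseteq> carrier (mat2_ring (residue_ring (int p)))"
    using p1 by (auto simp: s \<phi>_def)
  have hom: "\<phi> \<in> ring_hom (lipschitz_ring p) (mat2_ring (residue_ring (int p)))"
  proof (rule ring_hom_memI)
    fix x y assume "x \<in> carrier (lipschitz_ring p)" "y \<in> carrier (lipschitz_ring p)"
    then obtain a b c d a' b' c' d' where xy: "x = Quat a b c d" "y = Quat a' b' c' d'"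
      by (auto simp: s)
    show "\<phi> (x \<oplus>\<^bsub>lipschitz_ring p\<^esub> y) = \<phi> x \<oplus>\<^bsub>mat2_ring (residue_ring (int p))\<^esub> \<phi> y"
      by (simp only: xy s \<phi>_def quat.case mat2.inject, intro conjI;
        rule mod_eqI,
        (rule mod_congI | rule cong_add | rule cong_diff | rule cong_mult | rule cong_refl)+,
        simp add: algebra_simps)
    have e: "l mod int p = q mod int p"
      if "[l = l'] (mod int p)" "[q = q'] (mod int p)"
        "l' - q' = (r\<^sup>2 + t\<^sup>2 + 1) * u" for l q l' q' u
    proof -
      have "[l' = q'] (mod int p)" using that(3) rt by (simp add: cong_iff_dvd_diff)
      then show ?thesis using that(1,2) by (simp add: cong_def)
    qed
    show "\<phi> (x \<otimes>\<^bsub>lipschitz_ring p\<^esub> y) = \<phi> x \<otimes>\<^bsub>mat2_ring (residue_ring (int p))\<^esub> \<phi> y"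
      apply (simp only: xy s \<phi>_def quat.case mat2.inject, intro conjI)
         apply (rule e[where u = "- (c * c' + d * d')"],
        (rule mod_congI | rule cong_add | rule cong_diff | rule cong_mult | rule cong_refl)+,
        simp add: algebra_simps power2_eq_square)
        apply (rule e[where u = "d * c' - c * d'"],
        (rule mod_congI | rule cong_add | rule cong_diff | rule cong_mult | rule cong_refl)+,
        simp add: algebra_simps power2_eq_square)
       apply (rule e[where u = "c * d' - d * c'"],
        (rule mod_congI | rule cong_add | rule cong_diff | rule cong_mult | rule cong_refl)+,
        simp add: algebra_simps power2_eq_square)
      apply (rule e[where u = "- (c * c' + d * d')"],
        (rule mod_congI | rule cong_add | rule cong_diff | rule cong_mult | rule cong_refl)+,
        simp add: algebra_simps power2_eq_square)
      done
  qed (use p1 car in \<open>auto simp: s \<phi>_def image_subset_iff\<close>)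
  have zero: "z = 0" if "int p dvd z" "\<bar>z\<bar> < int p" for z
    using that dvd_imp_le_int[of z "int p"] by force
  have two: "int p dvd z" if "int p dvd 2 * z" for z
    using that assms by (metis coprime_dvd_mult_right_iff coprime_int_iff coprime_right_2_iff_odd
        of_nat_numeral)
  have inj: "inj_on \<phi> (carrier (lipschitz_ring p))"
  proof (rule inj_onI)
    fix x y assume "x \<in> carrier (lipschitz_ring p)" "y \<in> carrier (lipschitz_ring p)"
      and eq: "\<phi> x = \<phi> y"
    then obtain a b c d a' b' c' d' where xy: "x = Quat a b c d" "y = Quat a' b' c' d'"
      and bd: "{a, b, c, d, a', b', c', d'} \<subseteq> {0..<int p}"
      by (auto simp: s)
    define A B C D where "A = a - a'" and "B = b - b'" and "C = c - c'" and "D = d - d'"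
    have 1: "int p dvd A + r * C - t * D" and 2: "int p dvd t * C + r * D - B"
      and 3: "int p dvd B + t * C + r * D" and 4: "int p dvd A - r * C + t * D"
      using eq by (simp_all add: xy \<phi>_def mod_eq_dvd_iff A_def B_def C_def D_def algebra_simps)
    have "int p dvd A" by (rule two) (use dvd_add[OF 1 4] in \<open>simp add: algebra_simps\<close>)
    moreover have "int p dvd B" by (rule two) (use dvd_diff[OF 3 2] in \<open>simp add: algebra_simps\<close>)
    ultimately have 5: "int p dvd r * C - t * D" and 6: "int p dvd t * C + r * D"
      using dvd_diff[OF 1 \<open>int p dvd A\<close>] dvd_add[OF 2 \<open>int p dvd B\<close>] by (simp_all add: algebra_simps)
    have "(r\<^sup>2 + t\<^sup>2 + 1) * C - (r * (r * C - t * D) + t * (t * C + r * D)) = C"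
      by (simp add: algebra_simps power2_eq_square)
    then have "int p dvd C" using 5 6 rt by (metis dvd_add dvd_diff dvd_mult dvd_mult2)
    moreover have "(r\<^sup>2 + t\<^sup>2 + 1) * D - (r * (t * C + r * D) - t * (r * C - t * D)) = D"
      by (simp add: algebra_simps power2_eq_square)
    then have "int p dvd D" using 5 6 rt by (metis dvd_diff dvd_mult dvd_mult2)
    moreover have "\<bar>A\<bar> < int p" "\<bar>B\<bar> < int p" "\<bar>C\<bar> < int p" "\<bar>D\<bar> < int p"
      using bd by (auto simp: A_def B_def C_def D_def)
    ultimately have "A = 0" "B = 0" "C = 0" "D = 0"
      using \<open>int p dvd A\<close> \<open>int p dvd B\<close> zero by blast+
    then show "x = y" by (simp add: xy A_def B_def C_def D_def)
  qed
  define T where "T = {0..<int p} \<times> {0..<int p} \<times> {0..<int p} \<times> {0..<int p}"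
  have "carrier (lipschitz_ring p) = (\<lambda>(a, b, c, d). Quat a b c d) ` T"
    by (auto simp: s T_def image_iff)
  moreover have "inj_on (\<lambda>(a, b, c, d). Quat a b c d) T" by (auto simp: inj_on_def)
  moreover have M: "carrier (mat2_ring (residue_ring (int p))) = (\<lambda>(a, b, c, d). Mat2 a b c d) ` T"
    by (auto simp: s T_def image_iff)
  moreover have "inj_on (\<lambda>(a, b, c, d). Mat2 a b c d) T" by (auto simp: inj_on_def)
  ultimately have "card (carrier (lipschitz_ring p)) =
      card (carrier (mat2_ring (residue_ring (int p))))"
    by (simp add: card_image)
  moreover have "finite (carrier (mat2_ring (residue_ring (int p))))"
    unfolding M by (simp add: T_def)
  ultimately have "\<phi> ` carrier (lipschitz_ring p) = carrier (mat2_ring (residue_ring (int p)))"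
    using car inj by (intro card_subset_eq) (auto simp: card_image)
  then have "\<phi> \<in> ring_iso (lipschitz_ring p) (mat2_ring (residue_ring (int p)))"
    using hom inj by (simp add: ring_iso_def bij_betw_def)
  then show ?thesis by blast
qed

end

theory Submission
  imports Defs
begin

text \<open>
  The degree of a vertex \<open>x\<close> of a zero divisor graph is the number of elements other than \<open>0\<close> and
  \<open>x\<close> that annihilate \<open>x\<close> on at least one side, and this number is preserved by ring isomorphisms. So
  everything can be counted in the ring of \<open>2 \<times> 2\<close> matrices over a finite field with \<open>q\<close> elements.

  There a zero divisor has rank one, that is, it is an outer product \<open>u v\<^sup>T\<close> of nonzero vectors.
  In the plane the vectors orthogonal to a nonzero \<open>v\<close> are the multiples of one vector \<open>v\<^sup>\<bottom>\<close>
  (\<open>dot_zero_iff\<close>). Hence \<open>u v\<^sup>T B = 0\<close> means that both columns of \<open>B\<close> lie on the line of \<open>v\<^sup>\<bottom>\<close>,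
  i.e. that \<open>B\<close> is the outer product of \<open>v\<^sup>\<bottom>\<close> with some vector. There are \<open>q\<^sup>2\<close> such \<open>B\<close>. Likewise
  \<open>B u v\<^sup>T = 0\<close> means that \<open>B\<close> is the outer product of some vector with \<open>u\<^sup>\<bottom>\<close>, again \<open>q\<^sup>2\<close> matrices.
  The matrices of both kinds are the \<open>q\<close> multiples of the outer product of \<open>v\<^sup>\<bottom>\<close> and \<open>u\<^sup>\<bottom>\<close>. By
  inclusion and exclusion \<open>A = u v\<^sup>T\<close> has \<open>2 q\<^sup>2 - q\<close> one-sided annihilators
  (\<open>card_annihilators_outer\<close>).

  Zero is always among them and is not a neighbour. The matrix \<open>A\<close> itself is among them iff
  \<open>A\<^sup>2 = 0\<close>, iff \<open>v\<^sup>T u = 0\<close>, iff the line spanned by \<open>u\<close>, which is the image of \<open>A\<close>, is the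
  line spanned by \<open>v\<^sup>\<bottom>\<close>, which is the kernel (\<open>Ker_eq_Im_outer_iff\<close>). This gives the degree
  \<open>2 q\<^sup>2 - q - 2\<close> when kernel and image coincide and \<open>2 q\<^sup>2 - q - 1\<close> otherwise
  (\<open>card_neighbours\<close>). Both cases occur, for the matrix units at positions \<open>(1, 2)\<close> and
  \<open>(1, 1)\<close>.
\<close>

section \<open>Degrees in zero divisor graphs and ring isomorphisms\<close>

definition annihilators :: "('a, 'm) ring_scheme \<Rightarrow> 'a \<Rightarrow> 'a set" where
  "annihilators R x = {y \<in> carrier R. x \<otimes>\<^bsub>R\<^esub> y = \<zero>\<^bsub>R\<^esub> \<or> y \<otimes>\<^bsub>R\<^esub> x = \<zero>\<^bsub>R\<^esub>}"

text \<open>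
  A nonzero annihilator of \<open>x\<close> is automatically a vertex, because \<open>x\<close> itself witnesses that it is a
  zero divisor. So counting edges at \<open>x\<close> amounts to counting annihilators.
\<close>

lemma vertex_degree_zero_divisor_graph:
  assumes x: "x \<in> zero_divisors R"
  shows "vertex_degree (zero_divisor_graph R) x = card (annihilators R x - {\<zero>\<^bsub>R\<^esub>, x})"
proof -
  have "{e \<in> edges (zero_divisor_graph R). x \<in> e} =
      (\<lambda>y. {x, y}) ` (annihilators R x - {\<zero>\<^bsub>R\<^esub>, x})" (is "?L = ?E")
  proof
    show "?L \<subseteq> ?E"
      by (auto simp: edges_def zero_divisor_graph_def zero_divisors_def annihilators_def)
    show "?E \<subseteq> ?L"
    proof
      fix e assume "e \<in> ?E"
      then obtain y where y: "e = {x, y}" "y \<in> annihilators R x" "y \<noteq> \<zero>\<^bsub>R\<^esub>" "y \<noteq> x"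
        by auto
      then have "y \<in> zero_divisors R"
        using x by (auto simp: zero_divisors_def annihilators_def)
      then show "e \<in> ?L"
        using x y by (auto simp: edges_def zero_divisor_graph_def annihilators_def)
    qed
  qed
  moreover have "inj_on (\<lambda>y. {x, y}) (annihilators R x - {\<zero>\<^bsub>R\<^esub>, x})"
    by (auto simp: inj_on_def doubleton_eq_iff)
  ultimately show ?thesis
    by (simp add: vertex_degree_def card_image)
qed

text \<open>
  Multiplication alone forces this: zero of \<open>S\<close> has a preimage \<open>e\<close>, and
  \<open>\<phi> 0 = \<phi> (e 0) = \<phi> e \<phi> 0 = 0 \<phi> 0 = 0\<close>.
\<close>

lemma ring_iso_zero:
  assumes \<phi>: "\<phi> \<in> ring_iso R S"
    and R: "\<zero>\<^bsub>R\<^esub> \<in> carrier R" "\<And>x. x \<in> carrier R \<Longrightarrow> x \<otimes>\<^bsub>R\<^esub> \<zero>\<^bsub>R\<^esub> = \<zero>\<^bsub>R\<^esub>"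
    and S: "\<zero>\<^bsub>S\<^esub> \<in> carrier S" "\<And>y. y \<in> carrier S \<Longrightarrow> \<zero>\<^bsub>S\<^esub> \<otimes>\<^bsub>S\<^esub> y = \<zero>\<^bsub>S\<^esub>"
  shows "\<phi> \<zero>\<^bsub>R\<^esub> = \<zero>\<^bsub>S\<^esub>"
proof -
  have b: "bij_betw \<phi> (carrier R) (carrier S)"
    using \<phi> by (simp add: ring_iso_def)
  then obtain e where e: "e \<in> carrier R" "\<phi> e = \<zero>\<^bsub>S\<^esub>"
    using S(1) by (metis bij_betw_imp_surj_on imageE)
  have "\<phi> \<zero>\<^bsub>R\<^esub> = \<phi> (e \<otimes>\<^bsub>R\<^esub> \<zero>\<^bsub>R\<^esub>)"
    using R e by simp
  also have "\<dots> = \<phi> e \<otimes>\<^bsub>S\<^esub> \<phi> \<zero>\<^bsub>R\<^esub>"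
    using ring_hom_mult[of \<phi> R S e "\<zero>\<^bsub>R\<^esub>"] \<phi> R e by (simp add: ring_iso_def)
  also have "\<dots> = \<zero>\<^bsub>S\<^esub>"
    using e S b R(1) by (simp add: bij_betwE)
  finally show ?thesis .
qed

context
  fixes R :: "('a, 'm) ring_scheme" and S :: "('b, 'n) ring_scheme" and \<phi>
  assumes \<phi>: "\<phi> \<in> ring_iso R S"
    and zero: "\<phi> \<zero>\<^bsub>R\<^esub> = \<zero>\<^bsub>S\<^esub>" "\<zero>\<^bsub>R\<^esub> \<in> carrier R"
    and closed: "\<And>x y. x \<in> carrier R \<Longrightarrow> y \<in> carrier R \<Longrightarrow> x \<otimes>\<^bsub>R\<^esub> y \<in> carrier R"
begin

lemma ring_iso_mult_zero_iff:
  assumes "x \<in> carrier R" "y \<in> carrier R"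
  shows "\<phi> x \<otimes>\<^bsub>S\<^esub> \<phi> y = \<zero>\<^bsub>S\<^esub> \<longleftrightarrow> x \<otimes>\<^bsub>R\<^esub> y = \<zero>\<^bsub>R\<^esub>"
proof -
  have "\<phi> x \<otimes>\<^bsub>S\<^esub> \<phi> y = \<phi> (x \<otimes>\<^bsub>R\<^esub> y)"
    using ring_hom_mult[of \<phi> R S x y] \<phi> assms by (simp add: ring_iso_def)
  moreover have "inj_on \<phi> (carrier R)"
    using \<phi> by (simp add: ring_iso_def bij_betw_def)
  ultimately show ?thesis
    using assms zero closed by (metis inj_onD)
qed

lemma ring_iso_annihilators:
  assumes x: "x \<in> carrier R"
  shows "\<phi> ` annihilators R x = annihilators S (\<phi> x)"
proof -
  have b: "\<phi> ` carrier R = carrier S"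
    using \<phi> by (simp add: ring_iso_def bij_betw_def)
  show ?thesis
    unfolding annihilators_def b[symmetric] using x ring_iso_mult_zero_iff by auto
qed

lemma ring_iso_zero_divisors: "\<phi> ` zero_divisors R = zero_divisors S"
proof -
  have b: "\<phi> ` carrier R = carrier S" and i: "inj_on \<phi> (carrier R)"
    using \<phi> by (simp_all add: ring_iso_def bij_betw_def)
  have ne: "carrier S - {\<zero>\<^bsub>S\<^esub>} = \<phi> ` (carrier R - {\<zero>\<^bsub>R\<^esub>})"
    using inj_on_image_set_diff[OF i, of "carrier R" "{\<zero>\<^bsub>R\<^esub>}"] b zero by simp
  have "(\<exists>y \<in> \<phi> ` (carrier R - {\<zero>\<^bsub>R\<^esub>}). \<phi> x \<otimes>\<^bsub>S\<^esub> y = \<zero>\<^bsub>S\<^esub> \<or> y \<otimes>\<^bsub>S\<^esub> \<phi> x = \<zero>\<^bsub>S\<^esub>) \<longleftrightarrow>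
      (\<exists>y \<in> carrier R - {\<zero>\<^bsub>R\<^esub>}. x \<otimes>\<^bsub>R\<^esub> y = \<zero>\<^bsub>R\<^esub> \<or> y \<otimes>\<^bsub>R\<^esub> x = \<zero>\<^bsub>R\<^esub>)"
    if "x \<in> carrier R" for x
    using that by (simp add: bex_simps ring_iso_mult_zero_iff)
  then show ?thesis
    unfolding zero_divisors_def ne by auto
qed

lemma ring_iso_vertex_degree:
  assumes x: "x \<in> zero_divisors R"
  shows "vertex_degree (zero_divisor_graph R) x =
    card (annihilators S (\<phi> x) - {\<zero>\<^bsub>S\<^esub>, \<phi> x})"
proof -
  have i: "inj_on \<phi> (carrier R)"
    using \<phi> by (simp add: ring_iso_def bij_betw_def)
  have x': "x \<in> carrier R"
    using x by (simp add: zero_divisors_def)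
  have sub: "annihilators R x \<subseteq> carrier R"
    by (auto simp: annihilators_def)
  have "\<phi> ` (annihilators R x - {\<zero>\<^bsub>R\<^esub>, x}) = \<phi> ` annihilators R x - \<phi> ` {\<zero>\<^bsub>R\<^esub>, x}"
    by (rule inj_on_image_set_diff[OF i]) (use x' zero sub in auto)
  also have "\<dots> = annihilators S (\<phi> x) - {\<zero>\<^bsub>S\<^esub>, \<phi> x}"
    using ring_iso_annihilators[OF x'] zero by simp
  finally have "\<phi> ` (annihilators R x - {\<zero>\<^bsub>R\<^esub>, x}) = annihilators S (\<phi> x) - {\<zero>\<^bsub>S\<^esub>, \<phi> x}" .
  moreover have "inj_on \<phi> (annihilators R x - {\<zero>\<^bsub>R\<^esub>, x})"
    using i by (rule inj_on_subset) (use sub in auto)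
  ultimately show ?thesis
    using vertex_degree_zero_divisor_graph[OF x] card_image by fastforce
qed

end

section \<open>Outer products in the ring of two by two matrices\<close>

lemma mat2_ring_simps:
  "Mat2 a b c d \<in> carrier (mat2_ring R) \<longleftrightarrow>
     a \<in> carrier R \<and> b \<in> carrier R \<and> c \<in> carrier R \<and> d \<in> carrier R"
  "Mat2 a b c d \<otimes>\<^bsub>mat2_ring R\<^esub> Mat2 a' b' c' d' = Mat2
     (a \<otimes>\<^bsub>R\<^esub> a' \<oplus>\<^bsub>R\<^esub> b \<otimes>\<^bsub>R\<^esub> c') (a \<otimes>\<^bsub>R\<^esub> b' \<oplus>\<^bsub>R\<^esub> b \<otimes>\<^bsub>R\<^esub> d')
     (c \<otimes>\<^bsub>R\<^esub> a' \<oplus>\<^bsub>R\<^esub> d \<otimes>\<^bsub>R\<^esub> c') (c \<otimes>\<^bsub>R\<^esub> b' \<oplus>\<^bsub>R\<^esub> d \<otimes>\<^bsub>R\<^esub> d')"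
  "\<zero>\<^bsub>mat2_ring R\<^esub> = Mat2 \<zero>\<^bsub>R\<^esub> \<zero>\<^bsub>R\<^esub> \<zero>\<^bsub>R\<^esub> \<zero>\<^bsub>R\<^esub>"
  by (auto simp: mat2_ring_def)

fun outer :: "('a, 'm) ring_scheme \<Rightarrow> 'a \<times> 'a \<Rightarrow> 'a \<times> 'a \<Rightarrow> 'a mat2" where
  "outer R (a, b) (c, d) =
     Mat2 (a \<otimes>\<^bsub>R\<^esub> c) (a \<otimes>\<^bsub>R\<^esub> d) (b \<otimes>\<^bsub>R\<^esub> c) (b \<otimes>\<^bsub>R\<^esub> d)"

fun dot :: "('a, 'm) ring_scheme \<Rightarrow> 'a \<times> 'a \<Rightarrow> 'a \<times> 'a \<Rightarrow> 'a" where
  "dot R (a, b) (c, d) = a \<otimes>\<^bsub>R\<^esub> c \<oplus>\<^bsub>R\<^esub> b \<otimes>\<^bsub>R\<^esub> d"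

fun scale :: "('a, 'm) ring_scheme \<Rightarrow> 'a \<Rightarrow> 'a \<times> 'a \<Rightarrow> 'a \<times> 'a" where
  "scale R t (a, b) = (t \<otimes>\<^bsub>R\<^esub> a, t \<otimes>\<^bsub>R\<^esub> b)"

fun perp :: "('a, 'm) ring_scheme \<Rightarrow> 'a \<times> 'a \<Rightarrow> 'a \<times> 'a" where
  "perp R (a, b) = (b, \<ominus>\<^bsub>R\<^esub> a)"

context field
begin

text \<open>
  Kept opaque rather than abbreviated, so that automation treats vectors as single objects and does
  not split them into coordinates.
\<close>

definition plane :: "('a \<times> 'a) set" where
  "plane = carrier R \<times> carrier R"

lemma mem_plane [simp]: "(a, b) \<in> plane \<longleftrightarrow> a \<in> carrier R \<and> b \<in> carrier R"
  by (simp add: plane_def)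

text \<open>
  One equation cuts the plane down to a line: if the coordinate \<open>a\<close> of \<open>v = (a, b)\<close> is nonzero, the
  equation determines the first coordinate of \<open>x\<close> from the second, and otherwise the second
  coordinate vanishes. The descriptions of annihilators and kernels below reduce to this.
\<close>

lemma dot_zero_iff:
  assumes v: "v \<in> plane" "v \<noteq> (\<zero>, \<zero>)" and x: "x \<in> plane"
  shows "dot R v x = \<zero> \<longleftrightarrow> (\<exists>t \<in> carrier R. x = scale R t (perp R v))"
proof -
  obtain a b where ab: "v = (a, b)" by (cases v)
  obtain x1 x2 where xx: "x = (x1, x2)" by (cases x)
  have c: "a \<in> carrier R" "b \<in> carrier R" "x1 \<in> carrier R" "x2 \<in> carrier R"
    using v x by (auto simp: ab xx)
  have "\<exists>t \<in> carrier R. x1 = t \<otimes> b \<and> x2 = t \<otimes> (\<ominus> a)" if d: "a \<otimes> x1 \<oplus> b \<otimes> x2 = \<zero>"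
  proof (cases "a = \<zero>")
    case False
    then have i: "inv a \<in> carrier R" "inv a \<otimes> a = \<one>"
      using c field_Units by auto
    (* Comparing second coordinates in x = t (b, -a) forces t = - x2 / a. *)
    have "x1 = inv a \<otimes> (a \<otimes> x1)"
      using c i by (simp add: m_assoc[symmetric])
    also have "a \<otimes> x1 = \<ominus> (b \<otimes> x2)"
      using d c by (simp add: minus_equality)
    finally have x1: "x1 = (\<ominus> x2 \<otimes> inv a) \<otimes> b"
      using c i by (simp add: l_minus r_minus m_ac)
    have "(\<ominus> x2 \<otimes> inv a) \<otimes> (\<ominus> a) = x2 \<otimes> (inv a \<otimes> a)"
      using c i(1) by (simp add: l_minus r_minus m_ac)
    then have "x2 = (\<ominus> x2 \<otimes> inv a) \<otimes> (\<ominus> a)"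
      using i c by simp
    with x1 show ?thesis
      using c i by (intro bexI[of _ "\<ominus> x2 \<otimes> inv a"]) auto
  next
    case True
    then have "b \<noteq> \<zero>"
      using v by (simp add: ab)
    then have i: "inv b \<in> carrier R" "inv b \<otimes> b = \<one>"
      using c field_Units by auto
    have "x2 = \<zero>"
      using d True \<open>b \<noteq> \<zero>\<close> c by (simp add: integral_iff)
    moreover have "x1 = (x1 \<otimes> inv b) \<otimes> b"
      using c i by (simp add: m_assoc)
    ultimately show ?thesis
      using c i True by (intro bexI[of _ "x1 \<otimes> inv b"]) auto
  qed
  moreover have "a \<otimes> (t \<otimes> b) \<oplus> b \<otimes> (t \<otimes> (\<ominus> a)) = \<zero>" if "t \<in> carrier R" for t
    using that c by (simp add: r_minus m_ac r_neg)
  ultimately show ?thesis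
    by (auto simp: ab xx)
qed

lemma perp_plane: "v \<in> plane \<Longrightarrow> perp R v \<in> plane"
  by (cases v) auto

lemma perp_zero_iff: "v \<in> plane \<Longrightarrow> perp R v = (\<zero>, \<zero>) \<longleftrightarrow> v = (\<zero>, \<zero>)"
  by (cases v) (auto simp: add.inv_eq_1_iff)

lemma dot_commute: "u \<in> plane \<Longrightarrow> v \<in> plane \<Longrightarrow> dot R u v = dot R v u"
  by (cases u; cases v) (auto simp: m_comm)

lemma scale_plane: "t \<in> carrier R \<Longrightarrow> v \<in> plane \<Longrightarrow> scale R t v \<in> plane"
  by (cases v) auto

lemma scale_one: "v \<in> plane \<Longrightarrow> scale R \<one> v = v"
  by (cases v) auto

lemma scale_scale:
  "s \<in> carrier R \<Longrightarrow> t \<in> carrier R \<Longrightarrow> v \<in> plane \<Longrightarrow> scale R s (scale R t v) = scale R (s \<otimes> t) v"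
  by (cases v) (auto simp: m_assoc)

lemma inj_scale:
  assumes "v \<in> plane" "v \<noteq> (\<zero>, \<zero>)"
  shows "inj_on (\<lambda>t. scale R t v) (carrier R)"
  using assms by (cases v) (auto simp: inj_on_def m_rcancel)

lemma outer_carrier: "u \<in> plane \<Longrightarrow> v \<in> plane \<Longrightarrow> outer R u v \<in> carrier (mat2_ring R)"
  by (cases u; cases v) (auto simp: mat2_ring_simps)

lemma outer_zero_iff:
  assumes "u \<in> plane" "v \<in> plane"
  shows "outer R u v = \<zero>\<^bsub>mat2_ring R\<^esub> \<longleftrightarrow> u = (\<zero>, \<zero>) \<or> v = (\<zero>, \<zero>)"
  using assms by (cases u; cases v) (auto simp: mat2_ring_simps integral_iff)

lemma inj_outer_right:
  assumes "u \<in> plane" "u \<noteq> (\<zero>, \<zero>)"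
  shows "inj_on (outer R u) plane"
  using assms by (cases u) (auto simp: inj_on_def plane_def m_lcancel)

lemma inj_outer_left:
  assumes "v \<in> plane" "v \<noteq> (\<zero>, \<zero>)"
  shows "inj_on (\<lambda>u. outer R u v) plane"
  using assms by (cases v) (auto simp: inj_on_def plane_def m_rcancel)

lemma outer_mult_zero_iff:
  assumes u: "u \<in> plane" "u \<noteq> (\<zero>, \<zero>)" and v: "v \<in> plane"
    and B: "Mat2 a b c d \<in> carrier (mat2_ring R)"
  shows "outer R u v \<otimes>\<^bsub>mat2_ring R\<^esub> Mat2 a b c d = \<zero>\<^bsub>mat2_ring R\<^esub> \<longleftrightarrow>
    dot R v (a, c) = \<zero> \<and> dot R v (b, d) = \<zero>"
  using assms
  by (cases u; cases v) (auto simp: mat2_ring_simps m_assoc r_distr[symmetric] integral_iff)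

lemma mult_outer_zero_iff:
  assumes u: "u \<in> plane" and v: "v \<in> plane" "v \<noteq> (\<zero>, \<zero>)"
    and B: "Mat2 a b c d \<in> carrier (mat2_ring R)"
  shows "Mat2 a b c d \<otimes>\<^bsub>mat2_ring R\<^esub> outer R u v = \<zero>\<^bsub>mat2_ring R\<^esub> \<longleftrightarrow>
    dot R (a, b) u = \<zero> \<and> dot R (c, d) u = \<zero>"
  using assms
  by (cases u; cases v)
    (auto simp: mat2_ring_simps m_assoc[symmetric] l_distr[symmetric] integral_iff)

lemma columns_orthogonal_iff:
  assumes v: "v \<in> plane" "v \<noteq> (\<zero>, \<zero>)" and B: "Mat2 a b c d \<in> carrier (mat2_ring R)"
  shows "dot R v (a, c) = \<zero> \<and> dot R v (b, d) = \<zero> \<longleftrightarrow>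
    Mat2 a b c d \<in> outer R (perp R v) ` plane"
proof -
  have p: "(a, c) \<in> plane" "(b, d) \<in> plane"
    using B by (auto simp: mat2_ring_simps)
  obtain v1 v2 where vv: "perp R v = (v1, v2)" by (cases "perp R v")
  have "v1 \<in> carrier R" "v2 \<in> carrier R"
    using perp_plane[OF v(1)] vv by auto
  then show ?thesis
    unfolding dot_zero_iff[OF v p(1)] dot_zero_iff[OF v p(2)] vv
    by (force simp: plane_def image_iff m_comm)
qed

lemma rows_orthogonal_iff:
  assumes u: "u \<in> plane" "u \<noteq> (\<zero>, \<zero>)" and B: "Mat2 a b c d \<in> carrier (mat2_ring R)"
  shows "dot R (a, b) u = \<zero> \<and> dot R (c, d) u = \<zero> \<longleftrightarrow>
    Mat2 a b c d \<in> (\<lambda>w. outer R w (perp R u)) ` plane"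
proof -
  have p: "(a, b) \<in> plane" "(c, d) \<in> plane"
    using B by (auto simp: mat2_ring_simps)
  obtain u1 u2 where uu: "perp R u = (u1, u2)" by (cases "perp R u")
  have "u1 \<in> carrier R" "u2 \<in> carrier R"
    using perp_plane[OF u(1)] uu by auto
  then show ?thesis
    unfolding dot_commute[OF p(1) u(1)] dot_commute[OF p(2) u(1)]
      dot_zero_iff[OF u p(1)] dot_zero_iff[OF u p(2)] uu
    by (force simp: plane_def image_iff)
qed

text \<open>
  If \<open>A B = 0\<close> with \<open>B \<noteq> 0\<close>, then some nonzero column of \<open>B\<close> is orthogonal to both rows of \<open>A\<close>, so
  these rows are proportional to one vector. If \<open>B A = 0\<close>, a nonzero row of \<open>B\<close> does the same for
  the columns of \<open>A\<close>.
\<close>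

lemma zero_divisor_outer:
  assumes A: "A \<in> zero_divisors (mat2_ring R)"
  obtains u v where "u \<in> plane" "u \<noteq> (\<zero>, \<zero>)" "v \<in> plane" "v \<noteq> (\<zero>, \<zero>)" "A = outer R u v"
proof -
  obtain a b c d where A_eq: "A = Mat2 a b c d" by (cases A)
  obtain B where B: "B \<in> carrier (mat2_ring R)" "B \<noteq> \<zero>\<^bsub>mat2_ring R\<^esub>"
    and AB: "A \<otimes>\<^bsub>mat2_ring R\<^esub> B = \<zero>\<^bsub>mat2_ring R\<^esub> \<or> B \<otimes>\<^bsub>mat2_ring R\<^esub> A = \<zero>\<^bsub>mat2_ring R\<^esub>"
    using A by (auto simp: zero_divisors_def)
  obtain a' b' c' d' where B_eq: "B = Mat2 a' b' c' d'" by (cases B)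
  have cA: "Mat2 a b c d \<in> carrier (mat2_ring R)"
    using A by (simp add: zero_divisors_def A_eq)
  have "\<exists>u \<in> plane. \<exists>v \<in> plane. A = outer R u v"
    using AB
  proof
    assume 0: "A \<otimes>\<^bsub>mat2_ring R\<^esub> B = \<zero>\<^bsub>mat2_ring R\<^esub>"
    define x where "x = (if (a', c') = (\<zero>, \<zero>) then (b', d') else (a', c'))"
    have x: "x \<in> plane" "x \<noteq> (\<zero>, \<zero>)" "dot R (a, b) x = \<zero> \<and> dot R (c, d) x = \<zero>"
      using 0 B by (auto simp: x_def A_eq B_eq mat2_ring_simps)
    have "A \<in> (\<lambda>w. outer R w (perp R x)) ` plane"
      using x(3) unfolding rows_orthogonal_iff[OF x(1,2) cA] A_eq .
    then obtain w where "w \<in> plane" "A = outer R w (perp R x)"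
      by (rule imageE)
    then show ?thesis
      using perp_plane[OF x(1)] by metis
  next
    assume 0: "B \<otimes>\<^bsub>mat2_ring R\<^esub> A = \<zero>\<^bsub>mat2_ring R\<^esub>"
    define x where "x = (if (a', b') = (\<zero>, \<zero>) then (c', d') else (a', b'))"
    have x: "x \<in> plane" "x \<noteq> (\<zero>, \<zero>)" "dot R x (a, c) = \<zero> \<and> dot R x (b, d) = \<zero>"
      using 0 B by (auto simp: x_def A_eq B_eq mat2_ring_simps)
    have "A \<in> outer R (perp R x) ` plane"
      using x(3) unfolding columns_orthogonal_iff[OF x(1,2) cA] A_eq .
    then obtain w where "w \<in> plane" "A = outer R (perp R x) w"
      by (rule imageE)
    then show ?thesis
      using perp_plane[OF x(1)] by metis
  qed
  then show ?thesis
    using that A outer_zero_iff by (fastforce simp: zero_divisors_def)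
qed

section \<open>Counting annihilators\<close>

lemma right_annihilators_outer:
  assumes "u \<in> plane" "u \<noteq> (\<zero>, \<zero>)" "v \<in> plane" "v \<noteq> (\<zero>, \<zero>)"
  shows "{B \<in> carrier (mat2_ring R). outer R u v \<otimes>\<^bsub>mat2_ring R\<^esub> B = \<zero>\<^bsub>mat2_ring R\<^esub>} =
    outer R (perp R v) ` plane" (is "?L = ?E")
proof (rule Set.set_eqI)
  fix B :: "'a mat2"
  obtain a b c d where B: "B = Mat2 a b c d" by (cases B)
  show "B \<in> ?L \<longleftrightarrow> B \<in> ?E"
  proof (cases "B \<in> carrier (mat2_ring R)")
    case True
    then show ?thesis
      using outer_mult_zero_iff[OF assms(1-3)] columns_orthogonal_iff[OF assms(3,4)] B by simp
  next
    case False
    then show ?thesis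
      using outer_carrier perp_plane[OF assms(3)] by blast
  qed
qed

lemma left_annihilators_outer:
  assumes "u \<in> plane" "u \<noteq> (\<zero>, \<zero>)" "v \<in> plane" "v \<noteq> (\<zero>, \<zero>)"
  shows "{B \<in> carrier (mat2_ring R). B \<otimes>\<^bsub>mat2_ring R\<^esub> outer R u v = \<zero>\<^bsub>mat2_ring R\<^esub>} =
    (\<lambda>w. outer R w (perp R u)) ` plane" (is "?L = ?E")
proof (rule Set.set_eqI)
  fix B :: "'a mat2"
  obtain a b c d where B: "B = Mat2 a b c d" by (cases B)
  show "B \<in> ?L \<longleftrightarrow> B \<in> ?E"
  proof (cases "B \<in> carrier (mat2_ring R)")
    case True
    then show ?thesis
      using mult_outer_zero_iff[OF assms(1,3,4)] rows_orthogonal_iff[OF assms(1,2)] B by simp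
  next
    case False
    then show ?thesis
      using outer_carrier perp_plane[OF assms(1)] by blast
  qed
qed

lemma outer_mult_outer_zero_iff:
  assumes "u \<in> plane" "v \<in> plane" "w \<in> plane" "z \<in> plane"
    and "u \<noteq> (\<zero>, \<zero>)" "z \<noteq> (\<zero>, \<zero>)"
  shows "outer R u v \<otimes>\<^bsub>mat2_ring R\<^esub> outer R w z = \<zero>\<^bsub>mat2_ring R\<^esub> \<longleftrightarrow> dot R v w = \<zero>"
proof -
  obtain w1 w2 z1 z2 where e: "w = (w1, w2)" "z = (z1, z2)" by (cases w; cases z)
  obtain v1 v2 where v: "v = (v1, v2)" by (cases v)
  have B: "Mat2 (w1 \<otimes> z1) (w1 \<otimes> z2) (w2 \<otimes> z1) (w2 \<otimes> z2) \<in> carrier (mat2_ring R)"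
    using assms e outer_carrier by force
  show ?thesis
    using outer_mult_zero_iff[OF assms(1,5,2) B] assms unfolding e v
    by (auto simp: m_assoc[symmetric] l_distr[symmetric] integral_iff)
qed

text \<open>
  A right annihilator is an outer product of \<open>v\<^sup>\<bottom>\<close> with some \<open>w\<close>; it also annihilates from the left
  iff \<open>w\<close> is orthogonal to \<open>u\<close>, i.e. iff \<open>w\<close> is a multiple of \<open>u\<^sup>\<bottom>\<close>.
\<close>

lemma two_sided_annihilators_outer:
  assumes u: "u \<in> plane" "u \<noteq> (\<zero>, \<zero>)" and v: "v \<in> plane" "v \<noteq> (\<zero>, \<zero>)"
  shows "outer R (perp R v) ` plane \<inter> (\<lambda>w. outer R w (perp R u)) ` plane =
    (\<lambda>t. outer R (perp R v) (scale R t (perp R u))) ` carrier R"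
proof -
  have pv: "perp R v \<in> plane" "perp R v \<noteq> (\<zero>, \<zero>)"
    using v perp_plane perp_zero_iff by auto
  have "outer R (perp R v) w \<in> (\<lambda>w. outer R w (perp R u)) ` plane \<longleftrightarrow>
      (\<exists>t \<in> carrier R. w = scale R t (perp R u))" if w: "w \<in> plane" for w
  proof -
    have "outer R (perp R v) w \<in> (\<lambda>w. outer R w (perp R u)) ` plane \<longleftrightarrow>
        outer R (perp R v) w \<otimes>\<^bsub>mat2_ring R\<^esub> outer R u v = \<zero>\<^bsub>mat2_ring R\<^esub>"
      using left_annihilators_outer[OF u v] outer_carrier[OF pv(1) w] by blast
    also have "\<dots> \<longleftrightarrow> dot R w u = \<zero>"
      by (rule outer_mult_outer_zero_iff) (use assms pv w in auto)
    finally show ?thesis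
      using dot_zero_iff[OF u w] dot_commute[OF w u(1)] by simp
  qed
  moreover have "scale R t (perp R u) \<in> plane" if "t \<in> carrier R" for t
    using that scale_plane perp_plane[OF u(1)] by blast
  ultimately show ?thesis
    by blast
qed

lemma card_annihilators_outer:
  assumes fin: "finite (carrier R)"
    and u: "u \<in> plane" "u \<noteq> (\<zero>, \<zero>)" and v: "v \<in> plane" "v \<noteq> (\<zero>, \<zero>)"
  shows "card (annihilators (mat2_ring R) (outer R u v)) + card (carrier R) =
    2 * card (carrier R) ^ 2"
proof -
  have pu: "perp R u \<in> plane" "perp R u \<noteq> (\<zero>, \<zero>)" and pv: "perp R v \<in> plane" "perp R v \<noteq> (\<zero>, \<zero>)"
    using u v perp_plane perp_zero_iff by auto
  define X where "X = outer R (perp R v) ` plane"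
  define Y where "Y = (\<lambda>w. outer R w (perp R u)) ` plane"
  have "annihilators (mat2_ring R) (outer R u v) = X \<union> Y"
    using right_annihilators_outer[OF u v] left_annihilators_outer[OF u v]
    unfolding X_def Y_def annihilators_def by blast
  moreover have "card X = card (carrier R) ^ 2" "card Y = card (carrier R) ^ 2"
    unfolding X_def Y_def
    using inj_outer_right[OF pv] inj_outer_left[OF pu]
    by (simp_all add: plane_def card_image card_cartesian_product power2_eq_square)
  moreover have "card (X \<inter> Y) = card (carrier R)"
  proof -
    have "inj_on (\<lambda>t. outer R (perp R v) (scale R t (perp R u))) (carrier R)"
      using comp_inj_on[OF inj_scale[OF pu] inj_on_subset[OF inj_outer_right[OF pv]]]
        scale_plane[OF _ pu(1)] by (auto simp: comp_def image_subset_iff)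
    then show ?thesis
      unfolding X_def Y_def two_sided_annihilators_outer[OF u v] by (rule card_image)
  qed
  moreover have "finite X" "finite Y"
    using fin by (simp_all add: X_def Y_def plane_def)
  ultimately show ?thesis
    using card_Un_Int[of X Y] by simp
qed

section \<open>Kernel, image and degree\<close>

lemma Ker_outer:
  assumes u: "u \<in> plane" "u \<noteq> (\<zero>, \<zero>)" and v: "v \<in> plane"
  shows "mat2_Ker R (outer R u v) = {x \<in> plane. dot R v x = \<zero>}"
  using assms
  by (cases u; cases v) (auto simp: mat2_Ker_def plane_def[symmetric] m_assoc r_distr[symmetric] integral_iff)

text \<open>
  The matrix sends \<open>x\<close> to \<open>v\<^sup>T x\<close> times \<open>u\<close>, and \<open>v\<^sup>T x\<close> takes every value in the field because \<open>v\<close>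
  has an invertible coordinate.
\<close>

lemma Im_outer:
  assumes u: "u \<in> plane" and v: "v \<in> plane" "v \<noteq> (\<zero>, \<zero>)"
  shows "mat2_Im R (outer R u v) = (\<lambda>t. scale R t u) ` carrier R"
proof -
  obtain u1 u2 v1 v2 where e: "u = (u1, u2)" "v = (v1, v2)" by (cases u; cases v)
  have c: "u1 \<in> carrier R" "u2 \<in> carrier R" "v1 \<in> carrier R" "v2 \<in> carrier R"
    using u v e by auto
  have app: "mat2_apply R (outer R u v) x = scale R (dot R v x) u" if "x \<in> plane" for x
    using that c by (cases x) (auto simp: e m_ac l_distr r_distr)
  have "dot R v ` plane = carrier R"
  proof
    show "dot R v ` plane \<subseteq> carrier R"
      using c by (auto simp: e plane_def)
    show "carrier R \<subseteq> dot R v ` plane"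
    proof
      fix t assume t: "t \<in> carrier R"
      show "t \<in> dot R v ` plane"
      proof (cases "v1 = \<zero>")
        case True
        then have "v2 \<in> Units R"
          using v c e field_Units by auto
        then have "t = dot R v (\<zero>, inv v2 \<otimes> t)"
          using t c True by (simp add: e m_assoc[symmetric])
        then show ?thesis
          by (rule image_eqI) (use t \<open>v2 \<in> Units R\<close> in simp)
      next
        case False
        then have "v1 \<in> Units R"
          using c field_Units by auto
        then have "t = dot R v (inv v1 \<otimes> t, \<zero>)"
          using t c by (simp add: e m_assoc[symmetric])
        then show ?thesis
          by (rule image_eqI) (use t \<open>v1 \<in> Units R\<close> in simp)
      qed
    qed
  qed
  moreover have "mat2_Im R (outer R u v) = (\<lambda>t. scale R t u) ` dot R v ` plane"
    unfolding mat2_Im_def plane_def[symmetric] image_image using app by (rule image_cong[OF refl])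
  ultimately show ?thesis
    by simp
qed

text \<open>
  The kernel is the line of \<open>v\<^sup>\<bottom>\<close> and the image the line of \<open>u\<close>. Two lines through the origin agree
  as soon as one contains a nonzero point of the other.
\<close>

lemma Ker_eq_Im_outer_iff:
  assumes u: "u \<in> plane" "u \<noteq> (\<zero>, \<zero>)" and v: "v \<in> plane" "v \<noteq> (\<zero>, \<zero>)"
  shows "mat2_Ker R (outer R u v) = mat2_Im R (outer R u v) \<longleftrightarrow> dot R v u = \<zero>"
proof
  assume *: "mat2_Ker R (outer R u v) = mat2_Im R (outer R u v)"
  have "u \<in> mat2_Im R (outer R u v)"
    unfolding Im_outer[OF u(1) v] using scale_one[OF u(1)] by (metis imageI one_closed)
  then show "dot R v u = \<zero>"
    unfolding *[symmetric] Ker_outer[OF u v(1)] by simp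
next
  assume "dot R v u = \<zero>"
  then obtain s where s: "s \<in> carrier R" "u = scale R s (perp R v)"
    using dot_zero_iff[OF v u(1)] by blast
  have pv: "perp R v \<in> plane"
    using v(1) by (rule perp_plane)
  have "s \<noteq> \<zero>"
    using u(2) s pv by (cases "perp R v") auto
  then have sU: "s \<in> Units R"
    using s field_Units by simp
  have "scale R t u = scale R (t \<otimes> s) (perp R v)" if "t \<in> carrier R" for t
    using that s pv by (simp add: scale_scale)
  moreover have "scale R t (perp R v) = scale R (t \<otimes> inv s) u" if "t \<in> carrier R" for t
    using that s pv sU by (simp add: scale_scale m_assoc)
  ultimately have "(\<lambda>t. scale R t u) ` carrier R = (\<lambda>t. scale R t (perp R v)) ` carrier R"
    using s(1) sU by (intro equalityI image_subsetI) (metis imageI m_closed Units_inv_closed)+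
  also have "\<dots> = {x \<in> plane. dot R v x = \<zero>}"
    using dot_zero_iff[OF v] scale_plane pv by blast
  finally show "mat2_Ker R (outer R u v) = mat2_Im R (outer R u v)"
    unfolding Ker_outer[OF u v(1)] Im_outer[OF u(1) v] by simp
qed

text \<open>
  From the annihilators of \<open>A\<close> one discards \<open>0\<close>, and also \<open>A\<close> when \<open>A\<^sup>2 = 0\<close>. The identity is stated
  additively because truncated subtraction of natural numbers would obscure it.
\<close>

lemma card_neighbours:
  assumes fin: "finite (carrier R)" and A: "A \<in> zero_divisors (mat2_ring R)"
  shows "card (annihilators (mat2_ring R) A - {\<zero>\<^bsub>mat2_ring R\<^esub>, A}) + card (carrier R) +
    (if mat2_Ker R A = mat2_Im R A then 2 else 1) = 2 * card (carrier R) ^ 2"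
proof -
  obtain u v where u: "u \<in> plane" "u \<noteq> (\<zero>, \<zero>)" and v: "v \<in> plane" "v \<noteq> (\<zero>, \<zero>)"
    and A_eq: "A = outer R u v"
    using zero_divisor_outer[OF A] .
  let ?N = "annihilators (mat2_ring R) A"
  have A0: "A \<in> carrier (mat2_ring R)" "A \<noteq> \<zero>\<^bsub>mat2_ring R\<^esub>"
    using A by (simp_all add: zero_divisors_def)
  have zN: "\<zero>\<^bsub>mat2_ring R\<^esub> \<in> ?N"
    using A0(1) by (cases A) (auto simp: annihilators_def mat2_ring_simps)
  have AN: "A \<in> ?N \<longleftrightarrow> mat2_Ker R A = mat2_Im R A"
    using A0(1) outer_mult_outer_zero_iff[OF u(1) v(1) u(1) v(1) u(2) v(2)]
      Ker_eq_Im_outer_iff[OF u v] by (simp add: annihilators_def A_eq)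
  have finN: "finite ?N"
    using right_annihilators_outer[OF u v] left_annihilators_outer[OF u v] fin
    unfolding annihilators_def A_eq
    by (simp add: Collect_disj_eq conj_disj_distribL plane_def)
  have "card (?N - {\<zero>\<^bsub>mat2_ring R\<^esub>, A}) + card ({\<zero>\<^bsub>mat2_ring R\<^esub>, A} \<inter> ?N) = card ?N"
    using finN by (metis Int_commute add.commute card_Int_Diff)
  moreover have "{\<zero>\<^bsub>mat2_ring R\<^esub>, A} \<inter> ?N =
      (if mat2_Ker R A = mat2_Im R A then {\<zero>\<^bsub>mat2_ring R\<^esub>, A} else {\<zero>\<^bsub>mat2_ring R\<^esub>})"
    using zN AN by auto
  ultimately show ?thesis
    using card_annihilators_outer[OF fin u v, folded A_eq] A0(2) by (simp split: if_splits)
qed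

text \<open>
  The outer product of \<open>v\<^sup>\<bottom>\<close> with any nonzero vector, for instance with \<open>v\<close>, is a nonzero right
  annihilator.
\<close>

lemma outer_zero_divisor:
  assumes u: "u \<in> plane" "u \<noteq> (\<zero>, \<zero>)" and v: "v \<in> plane" "v \<noteq> (\<zero>, \<zero>)"
  shows "outer R u v \<in> zero_divisors (mat2_ring R)"
proof -
  let ?B = "outer R (perp R v) v"
  have pv: "perp R v \<in> plane" "perp R v \<noteq> (\<zero>, \<zero>)"
    using v perp_plane perp_zero_iff by auto
  have "?B \<in> outer R (perp R v) ` plane"
    using v by blast
  then have "outer R u v \<otimes>\<^bsub>mat2_ring R\<^esub> ?B = \<zero>\<^bsub>mat2_ring R\<^esub>"
    using right_annihilators_outer[OF u v] by blast
  moreover have "?B \<in> carrier (mat2_ring R) - {\<zero>\<^bsub>mat2_ring R\<^esub>}"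
    using outer_carrier[OF pv(1) v(1)] outer_zero_iff[OF pv(1) v(1)] pv(2) v(2) by simp
  moreover have "outer R u v \<in> carrier (mat2_ring R) - {\<zero>\<^bsub>mat2_ring R\<^esub>}"
    using outer_carrier[OF u(1) v(1)] outer_zero_iff[OF u(1) v(1)] u(2) v(2) by simp
  ultimately show ?thesis
    unfolding zero_divisors_def by blast
qed

lemma ex_zero_divisor_Ker_Im:
  "\<exists>A \<in> zero_divisors (mat2_ring R). mat2_Ker R A = mat2_Im R A"
  "\<exists>A \<in> zero_divisors (mat2_ring R). mat2_Ker R A \<noteq> mat2_Im R A"
proof -
  have e: "(\<one>, \<zero>) \<in> plane" "(\<one>, \<zero>) \<noteq> (\<zero>, \<zero>)" and f: "(\<zero>, \<one>) \<in> plane" "(\<zero>, \<one>) \<noteq> (\<zero>, \<zero>)"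
    by auto
  show "\<exists>A \<in> zero_divisors (mat2_ring R). mat2_Ker R A = mat2_Im R A"
    using Ker_eq_Im_outer_iff[OF e f] by (intro bexI[OF _ outer_zero_divisor[OF e f]]) simp
  show "\<exists>A \<in> zero_divisors (mat2_ring R). mat2_Ker R A \<noteq> mat2_Im R A"
    using Ker_eq_Im_outer_iff[OF e e] by (intro bexI[OF _ outer_zero_divisor[OF e e]]) simp
qed

end

section \<open>Lipschitz quaternions modulo an odd prime\<close>

theorem corollary3p4:
  fixes p :: nat
  assumes "prime p" and "odd p"
  shows
    "(\<forall>\<phi> \<in> ring_iso (lipschitz_ring p) (mat2_ring (residue_ring (int p))).
        \<forall>A \<in> verts (lipschitz_graph p).
          (mat2_Ker (residue_ring (int p)) (\<phi> A) = mat2_Im (residue_ring (int p)) (\<phi> A) \<longrightarrow>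
             int (vertex_degree (lipschitz_graph p) A) = 2 * int p * (int p - 1) + (int p - 2) \<and>
             2 * int p * (int p - 1) + (int p - 2) = 2 * int p ^ 2 - int p - 2) \<and>
          (mat2_Ker (residue_ring (int p)) (\<phi> A) \<noteq> mat2_Im (residue_ring (int p)) (\<phi> A) \<longrightarrow>
             int (vertex_degree (lipschitz_graph p) A) = (2 * int p + 1) * (int p - 1) \<and>
             (2 * int p + 1) * (int p - 1) = 2 * int p ^ 2 - int p - 1)) \<and>
     card (vertex_degree (lipschitz_graph p) ` verts (lipschitz_graph p)) = 2 \<and>
     (\<exists>d. vertex_degree (lipschitz_graph p) ` verts (lipschitz_graph p) = {d, d + 1})"
proof -
  have p1: "p > 1"
    using assms(1) prime_gt_1_nat by blast
  let ?F = "residue_ring (int p)"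
  let ?L = "lipschitz_ring p"
  let ?M = "mat2_ring ?F"
  let ?deg = "vertex_degree (lipschitz_graph p)"
  let ?V = "verts (lipschitz_graph p)"
  interpret F: residues_prime p ?F
    using assms(1) by unfold_locales auto
  interpret F: field ?F
    by (rule F.is_field)
  interpret L: ring ?L
    using p1 by (rule lipschitz_ring_ring)
  have cardF: "finite (carrier ?F)" "card (carrier ?F) = p"
    using p1 by (simp_all add: residue_ring_simps)
  have V: "?V = zero_divisors ?L"
    by (simp add: verts_def lipschitz_graph_def zero_divisor_graph_def)
  have zero: "\<phi> \<zero>\<^bsub>?L\<^esub> = \<zero>\<^bsub>?M\<^esub>" if "\<phi> \<in> ring_iso ?L ?M" for \<phi>
  proof (rule ring_iso_zero[OF that])
    fix Y assume "Y \<in> carrier ?M"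
    then show "\<zero>\<^bsub>?M\<^esub> \<otimes>\<^bsub>?M\<^esub> Y = \<zero>\<^bsub>?M\<^esub>"
      by (cases Y) (simp add: mat2_ring_simps)
  qed (simp_all add: mat2_ring_simps)
  have image: "\<phi> ` ?V = zero_divisors ?M" if "\<phi> \<in> ring_iso ?L ?M" for \<phi>
    using ring_iso_zero_divisors[OF that zero[OF that]] V by simp
  have deg: "?deg A + p + (if mat2_Ker ?F (\<phi> A) = mat2_Im ?F (\<phi> A) then 2 else 1) = 2 * p ^ 2"
    if \<phi>: "\<phi> \<in> ring_iso ?L ?M" and A: "A \<in> ?V" for \<phi> A
  proof -
    have "?deg A = card (annihilators ?M (\<phi> A) - {\<zero>\<^bsub>?M\<^esub>, \<phi> A})"
      using ring_iso_vertex_degree[OF \<phi> zero[OF \<phi>]] A V by (simp add: lipschitz_graph_def)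
    moreover have "\<phi> A \<in> zero_divisors ?M"
      using image[OF \<phi>] A by blast
    ultimately show ?thesis
      using F.card_neighbours[OF cardF(1)] cardF(2) by metis
  qed
  have eq: "2 * int p * (int p - 1) + (int p - 2) = 2 * int p ^ 2 - int p - 2"
    "(2 * int p + 1) * (int p - 1) = 2 * int p ^ 2 - int p - 1"
    by (simp_all add: algebra_simps power2_eq_square)
  have int_deg: "int (?deg A) = 2 * int p ^ 2 - int p -
      (if mat2_Ker ?F (\<phi> A) = mat2_Im ?F (\<phi> A) then 2 else 1)"
    if \<phi>: "\<phi> \<in> ring_iso ?L ?M" and A: "A \<in> ?V" for \<phi> A
    using arg_cong[OF deg[OF that], of int] by (simp split: if_splits)
  obtain \<phi> where \<phi>: "\<phi> \<in> ring_iso ?L ?M"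
    using lipschitz_mat2_iso[OF assms] by blast
  obtain A B where A: "A \<in> ?V" "mat2_Ker ?F (\<phi> A) = mat2_Im ?F (\<phi> A)"
    and B: "B \<in> ?V" "mat2_Ker ?F (\<phi> B) \<noteq> mat2_Im ?F (\<phi> B)"
    using F.ex_zero_divisor_Ker_Im unfolding image[OF \<phi>, symmetric] by blast
  have "?deg C = ?deg A \<or> ?deg C = ?deg A + 1" if "C \<in> ?V" for C
    using deg[OF \<phi> that] deg[OF \<phi> A(1)] A(2) by (simp split: if_splits)
  moreover have "?deg B = ?deg A + 1"
    using deg[OF \<phi> B(1)] deg[OF \<phi> A(1)] A(2) B(2) by simp
  ultimately have im: "?deg ` ?V = {?deg A, ?deg A + 1}"
    using A(1) B(1) by force
  then have "card (?deg ` ?V) = 2"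
    by simp
  with im int_deg eq show ?thesis
    by auto
qed

end
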